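(* Let $x_1,x_2,x_3,x_4$ be prime numbers and let $a,b$ be positive integers such that (i) $x_1+x_2+x_3+x_4=a^2$; (ii) $\sum_{i=1}^{4}\mathrm{dgs}(x_i)=b^2$; (iii) $\mathrm{dgs}(a^2)+\mathrm{dgs}(b^2)=\mathrm{dgs}(a^2+b^2)$; (iv) $a^2+b^2$ is a prime of the form $4s+1$ for some positive integer $s$. Then $b$ is not a multiple of $3$.
   Context: For a positive integer $n$, $\mathrm{dgs}(n)$ denotes the sum of all digits of $n$ in its decimal representation. The primes $x_1,\dots,x_4$ need not be distinct. *)

theory Defs
  imports "HOL-Computational_Algebra.Primes"
begin

fun dgs :: "nat \<Rightarrow> nat" where
  "dgs n = (if n = 0 then 0 else n mod 10 + dgs (n div 10))"

(* The defining equation loops as a rewrite rule. *)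
declare dgs.simps [simp del]

end

theory Submission
  imports Defs "HOL-Number_Theory.Cong"
begin

text \<open>Casting out nines: since 10 is 1 modulo 9, a number and its digit sum agree modulo 9
  (\<open>cong_dgs\<close>). Summing over the four primes makes \<open>a\<^sup>2\<close> and
  \<open>b\<^sup>2\<close> congruent modulo 9. If 3 divided \<open>b\<close>, then 9 would divide
  both squares, hence their sum, which is prime.\<close>

lemma cong_dgs: "[dgs n = n] (mod 9)"
proof (induction n rule: dgs.induct)
  case (1 n)
  show ?case
  proof (cases "n = 0")
    case False
    have "[dgs n = n mod 10 + n div 10] (mod 9)"
      using False 1 by (subst dgs.simps) (simp add: cong_add)
    \<comment> \<open>The added multiple of 9 raises the weight of the quotient from 1 to 10, which
      restores \<open>n\<close>.\<close>
    also have "[n mod 10 + n div 10 = n mod 10 + n div 10 + 9 * (n div 10)] (mod 9)"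
      by (simp only: cong_def mod_mult_self2)
    also have "n mod 10 + n div 10 + 9 * (n div 10) = n"
      using div_mult_mod_eq[of n 10] by linarith
    finally show ?thesis .
  qed (simp add: dgs.simps)
qed

theorem proposition4p2:
  fixes x1 x2 x3 x4 a b :: nat
  assumes "prime x1" and "prime x2" and "prime x3" and "prime x4"
    and "a > 0" and "b > 0"
    and "x1 + x2 + x3 + x4 = a\<^sup>2"
    and "dgs x1 + dgs x2 + dgs x3 + dgs x4 = b\<^sup>2"
    and "dgs (a\<^sup>2) + dgs (b\<^sup>2) = dgs (a\<^sup>2 + b\<^sup>2)"
    and "prime (a\<^sup>2 + b\<^sup>2)"
    and "\<exists>s>0. a\<^sup>2 + b\<^sup>2 = 4 * s + 1"
  shows "\<not> 3 dvd b"
proof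
  assume "3 dvd b"
  then have b2: "9 dvd b\<^sup>2"
    using dvd_power_same[of 3 b 2] by simp
  \<comment> \<open>With both squares expanded into their four-term sums, the congruence splits into
    one instance of \<open>cong_dgs\<close> per prime.\<close>
  have "[b\<^sup>2 = a\<^sup>2] (mod 9)"
    unfolding assms(7,8)[symmetric] by (intro cong_add cong_dgs)
  then have "9 dvd a\<^sup>2"
    using b2 cong_dvd_iff by blast
  then have "9 dvd a\<^sup>2 + b\<^sup>2"
    using b2 by (rule dvd_add)
  then have "3 * 3 dvd a\<^sup>2 + b\<^sup>2"
    by simp
  \<comment> \<open>Divisibility by 3 alone would still allow the prime 3; the second factor 3
    excludes it.\<close>
  then have "3 dvd a\<^sup>2 + b\<^sup>2" and "a\<^sup>2 + b\<^sup>2 \<noteq> 3"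
    by (auto dest: dvd_mult_left)
  then show False
    using assms(10) by (auto simp: prime_nat_iff)
qed

end
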